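(* If $\Psi=\Psi(s,t)$ is a solution of the Betchov-Da Rios equation $\Psi_t=\Psi_s\times\Psi_{ss}\times\Psi_{sss}$ in $E^4$ (with unit speed $s$-parameter curves), then the invariants $k$ and $h$ of the soliton surface $S:\Psi=\Psi(s,t)$ are, according to the parallel transport frame field, $$k(s,t)=-\frac{\mathcal{B}^2+4Q^2\mathcal{A}\mathcal{C}^2}{\mathcal{W}^6}\qquad\text{and}\qquad h(s,t)=\frac{(Q^2\mathcal{W}^2-\mathcal{A})\,\mathcal{C}}{\mathcal{W}^4}.$$
   Context: Setting. $E^4$ is $\mathbb{R}^4$ with its standard inner product $\langle\cdot,\cdot\rangle$ and orientation; the ternary vector product $x\times y\times z$ is the formal determinant of the $4\times4$ matrix whose first row is the standard basis $(e_1,e_2,e_3,e_4)$ and whose remaining rows are $x,y,z$. Subscripts $s,t$ denote partial derivatives. $\Psi=\Psi(s,t)$ is a smooth map from a product of two open intervals to $E^4$ whose $s$-parameter curves $s\mapsto\Psi(s,t)$ are unit speed for all $t$. A parallel transport frame field is a smooth positively oriented orthonormal frame $\{\mathcal{T},\mathcal{P}_1,\mathcal{P}_2,\mathcal{P}_3\}$ along $\Psi$ with $\mathcal{T}=\Psi_s$, $\mathcal{T}_s=k_1\mathcal{P}_1+k_2\mathcal{P}_2+k_3\mathcal{P}_3$ and $(\mathcal{P}_i)_s=-k_i\mathcal{T}$; $k_1,k_2,k_3$ are its curvature functions. Put $\mathfrak{a}_{23}=\langle(\mathcal{P}_1)_t,\mathcal{P}_2\rangle$, $\mathfrak{a}_{24}=\langle(\mathcal{P}_1)_t,\mathcal{P}_3\rangle$,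 $\mathfrak{a}_{34}=\langle(\mathcal{P}_2)_t,\mathcal{P}_3\rangle$, $P=k_3(k_2)_s-k_2(k_3)_s$, $R=k_1(k_3)_s-k_3(k_1)_s$, $S=k_2(k_1)_s-k_1(k_2)_s$ (the function $S$ is not to be confused with the surface), $Q=\sqrt{k_1^2+k_2^2+k_3^2}$, $\mathcal{W}=\sqrt{P^2+R^2+S^2}$, and $\mathcal{A}=(Pk_3-Sk_1)\mathfrak{a}_{24}+(Pk_2-Rk_1)\mathfrak{a}_{23}+(Rk_3-Sk_2)\mathfrak{a}_{34}-R(k_2)_t-S(k_3)_t-P(k_1)_t$, $\mathcal{B}=\mathcal{W}^2(k_1\mathfrak{a}_{34}-k_2\mathfrak{a}_{24}+k_3\mathfrak{a}_{23})+S(k_2P_t-k_1R_t)+R(k_1S_t-k_3P_t)+P(k_3R_t-k_2S_t)$, $\mathcal{C}=(k_1)_sP_s+(k_2)_sR_s+(k_3)_sS_s$. Standing assumptions: at least two of $k_1,k_2,k_3$ are non-zero, and $P,R,S$ are not all zero at any point. Invariants $k,h$. Let $g_{11}=\langle\Psi_s,\Psi_s\rangle$, $g_{12}=\langle\Psi_s,\Psi_t\rangle$, $g_{22}=\langle\Psi_t,\Psi_t\rangle$. The orthonormal normal frame used is $N_1=\frac{1}{Q}(k_1\mathcal{P}_1+k_2\mathcal{P}_2+k_3\mathcal{P}_3)$, $N_2=\frac{1}{Q\mathcal{W}}\big((k_2S-k_3R)\mathcal{P}_1+(k_3P-k_1S)\mathcal{P}_2+(k_1R-k_2P)\mathcal{P}_3\big)$.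 Let $c_{11}^i=\langle\Psi_{ss},N_i\rangle$, $c_{12}^i=\langle\Psi_{st},N_i\rangle$, $c_{22}^i=\langle\Psi_{tt},N_i\rangle$, $\Delta_1=c_{11}^1c_{12}^2-c_{12}^1c_{11}^2$, $\Delta_2=c_{11}^1c_{22}^2-c_{22}^1c_{11}^2$, $\Delta_3=c_{12}^1c_{22}^2-c_{22}^1c_{12}^2$, and $l_{11}=2\Delta_1/\mathcal{W}$, $l_{12}=\Delta_2/\mathcal{W}$, $l_{22}=2\Delta_3/\mathcal{W}$. Let $\gamma$ be the matrix $\begin{bmatrix}\gamma_1^1&\gamma_1^2\\\gamma_2^1&\gamma_2^2\end{bmatrix}$ with, for $D=g_{11}g_{22}-g_{12}^2$, $\gamma_1^1=(g_{12}l_{12}-g_{22}l_{11})/D$, $\gamma_1^2=(g_{12}l_{11}-g_{11}l_{12})/D$, $\gamma_2^1=(g_{12}l_{22}-g_{22}l_{12})/D$, $\gamma_2^2=(g_{12}l_{12}-g_{11}l_{22})/D$. Then $k=\det\gamma$ and $h=-\tfrac12\operatorname{tr}\gamma$. *)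

theory Defs
  imports "HOL-Analysis.Analysis"
begin

text \<open>Only meaningful for open \<open>U\<close>, since the derivatives are two-sided; with finite-dimensional
  domain this is \<open>C\<^sup>n\<close>.\<close>

primrec times_differentiable_on ::
  "nat \<Rightarrow> 'a::real_normed_vector set \<Rightarrow> ('a \<Rightarrow> 'b::real_normed_vector) \<Rightarrow> bool" where
  "times_differentiable_on 0 U f \<longleftrightarrow> continuous_on U f"
| "times_differentiable_on (Suc n) U f \<longleftrightarrow>
     (\<forall>x\<in>U. f differentiable (at x)) \<and>
     (\<forall>v. times_differentiable_on n U (\<lambda>x. frechet_derivative f (at x) v))"

definition smooth_on :: "'a::real_normed_vector set \<Rightarrow> ('a \<Rightarrow> 'b::real_normed_vector) \<Rightarrow> bool" where
  "smooth_on U f \<longleftrightarrow> (\<forall>n. times_differentiable_on n U f)"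

definition pd_s :: "(real \<times> real \<Rightarrow> 'b::real_normed_vector) \<Rightarrow> real \<times> real \<Rightarrow> 'b" where
  "pd_s f = (\<lambda>(s, t). vector_derivative (\<lambda>x. f (x, t)) (at s))"

definition pd_t :: "(real \<times> real \<Rightarrow> 'b::real_normed_vector) \<Rightarrow> real \<times> real \<Rightarrow> 'b" where
  "pd_t f = (\<lambda>(s, t). vector_derivative (\<lambda>y. f (s, y)) (at t))"

text \<open>The formal determinant with first row \<open>(e\<^sub>1, e\<^sub>2, e\<^sub>3, e\<^sub>4)\<close>: its \<open>i\<close>-th component,
  i.e. the coefficient of \<open>e\<^sub>i\<close>, is obtained by putting 1 for \<open>e\<^sub>i\<close> and 0 for the other
  basis vectors.\<close>

definition ternary_product :: "real^4 \<Rightarrow> real^4 \<Rightarrow> real^4 \<Rightarrow> real^4" where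
  "ternary_product x y z = (\<chi> i. det (vector [axis i 1, x, y, z] :: real^4^4))"

definition betchov_da_rios :: "(real \<times> real) set \<Rightarrow> (real \<times> real \<Rightarrow> real^4) \<Rightarrow> bool" where
  "betchov_da_rios U \<Psi> \<longleftrightarrow>
     (\<forall>p\<in>U. pd_t \<Psi> p = ternary_product (pd_s \<Psi> p) (pd_s (pd_s \<Psi>) p) (pd_s (pd_s (pd_s \<Psi>)) p))"

text \<open>The vectors \<open>\<P>\<^sub>i\<close> and the curvature functions \<open>k\<^sub>i\<close> are families over the
  three-element index type.\<close>

definition parallel_transport_frame ::
  "(real \<times> real) set \<Rightarrow> (real \<times> real \<Rightarrow> real^4) \<Rightarrow> (real \<times> real \<Rightarrow> real^4) \<Rightarrow>
   (3 \<Rightarrow> real \<times> real \<Rightarrow> real^4) \<Rightarrow> (3 \<Rightarrow> real \<times> real \<Rightarrow> real) \<Rightarrow> bool" where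
  "parallel_transport_frame U \<Psi> \<T> \<P> k \<longleftrightarrow>
     smooth_on U \<T> \<and> (\<forall>i. smooth_on U (\<P> i)) \<and>
     (\<forall>p\<in>U.
        \<T> p \<bullet> \<T> p = 1 \<and> (\<forall>i. \<T> p \<bullet> \<P> i p = 0) \<and>
        (\<forall>i j. \<P> i p \<bullet> \<P> j p = (if i = j then 1 else 0)) \<and>
        det (vector [\<T> p, \<P> 1 p, \<P> 2 p, \<P> 3 p] :: real^4^4) > 0 \<and>
        \<T> p = pd_s \<Psi> p \<and>
        pd_s \<T> p = k 1 p *\<^sub>R \<P> 1 p + k 2 p *\<^sub>R \<P> 2 p + k 3 p *\<^sub>R \<P> 3 p \<and>
        (\<forall>i. pd_s (\<P> i) p = - (k i p *\<^sub>R \<T> p)))"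

definition coef_a23 :: "(3 \<Rightarrow> real \<times> real \<Rightarrow> real^4) \<Rightarrow> real \<times> real \<Rightarrow> real" where
  "coef_a23 \<P> p = pd_t (\<P> 1) p \<bullet> \<P> 2 p"

definition coef_a24 :: "(3 \<Rightarrow> real \<times> real \<Rightarrow> real^4) \<Rightarrow> real \<times> real \<Rightarrow> real" where
  "coef_a24 \<P> p = pd_t (\<P> 1) p \<bullet> \<P> 3 p"

definition coef_a34 :: "(3 \<Rightarrow> real \<times> real \<Rightarrow> real^4) \<Rightarrow> real \<times> real \<Rightarrow> real" where
  "coef_a34 \<P> p = pd_t (\<P> 2) p \<bullet> \<P> 3 p"

definition P_of :: "(3 \<Rightarrow> real \<times> real \<Rightarrow> real) \<Rightarrow> real \<times> real \<Rightarrow> real" where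
  "P_of k p = k 3 p * pd_s (k 2) p - k 2 p * pd_s (k 3) p"

definition R_of :: "(3 \<Rightarrow> real \<times> real \<Rightarrow> real) \<Rightarrow> real \<times> real \<Rightarrow> real" where
  "R_of k p = k 1 p * pd_s (k 3) p - k 3 p * pd_s (k 1) p"

definition S_of :: "(3 \<Rightarrow> real \<times> real \<Rightarrow> real) \<Rightarrow> real \<times> real \<Rightarrow> real" where
  "S_of k p = k 2 p * pd_s (k 1) p - k 1 p * pd_s (k 2) p"

definition Q_of :: "(3 \<Rightarrow> real \<times> real \<Rightarrow> real) \<Rightarrow> real \<times> real \<Rightarrow> real" where
  "Q_of k p = sqrt ((k 1 p)\<^sup>2 + (k 2 p)\<^sup>2 + (k 3 p)\<^sup>2)"

definition W_of :: "(3 \<Rightarrow> real \<times> real \<Rightarrow> real) \<Rightarrow> real \<times> real \<Rightarrow> real" where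
  "W_of k p = sqrt ((P_of k p)\<^sup>2 + (R_of k p)\<^sup>2 + (S_of k p)\<^sup>2)"

definition A_of ::
  "(3 \<Rightarrow> real \<times> real \<Rightarrow> real^4) \<Rightarrow> (3 \<Rightarrow> real \<times> real \<Rightarrow> real) \<Rightarrow> real \<times> real \<Rightarrow> real" where
  "A_of \<P> k p =
     (P_of k p * k 3 p - S_of k p * k 1 p) * coef_a24 \<P> p
   + (P_of k p * k 2 p - R_of k p * k 1 p) * coef_a23 \<P> p
   + (R_of k p * k 3 p - S_of k p * k 2 p) * coef_a34 \<P> p
   - R_of k p * pd_t (k 2) p - S_of k p * pd_t (k 3) p - P_of k p * pd_t (k 1) p"

definition B_of ::
  "(3 \<Rightarrow> real \<times> real \<Rightarrow> real^4) \<Rightarrow> (3 \<Rightarrow> real \<times> real \<Rightarrow> real) \<Rightarrow> real \<times> real \<Rightarrow> real" where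
  "B_of \<P> k p =
     (W_of k p)\<^sup>2 * (k 1 p * coef_a34 \<P> p - k 2 p * coef_a24 \<P> p + k 3 p * coef_a23 \<P> p)
   + S_of k p * (k 2 p * pd_t (P_of k) p - k 1 p * pd_t (R_of k) p)
   + R_of k p * (k 1 p * pd_t (S_of k) p - k 3 p * pd_t (P_of k) p)
   + P_of k p * (k 3 p * pd_t (R_of k) p - k 2 p * pd_t (S_of k) p)"

definition C_of :: "(3 \<Rightarrow> real \<times> real \<Rightarrow> real) \<Rightarrow> real \<times> real \<Rightarrow> real" where
  "C_of k p = pd_s (k 1) p * pd_s (P_of k) p + pd_s (k 2) p * pd_s (R_of k) p
            + pd_s (k 3) p * pd_s (S_of k) p"

definition g11 :: "(real \<times> real \<Rightarrow> real^4) \<Rightarrow> real \<times> real \<Rightarrow> real" where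
  "g11 \<Psi> p = pd_s \<Psi> p \<bullet> pd_s \<Psi> p"

definition g12 :: "(real \<times> real \<Rightarrow> real^4) \<Rightarrow> real \<times> real \<Rightarrow> real" where
  "g12 \<Psi> p = pd_s \<Psi> p \<bullet> pd_t \<Psi> p"

definition g22 :: "(real \<times> real \<Rightarrow> real^4) \<Rightarrow> real \<times> real \<Rightarrow> real" where
  "g22 \<Psi> p = pd_t \<Psi> p \<bullet> pd_t \<Psi> p"

definition normal1 ::
  "(3 \<Rightarrow> real \<times> real \<Rightarrow> real^4) \<Rightarrow> (3 \<Rightarrow> real \<times> real \<Rightarrow> real) \<Rightarrow> real \<times> real \<Rightarrow> real^4" where
  "normal1 \<P> k p =
     (1 / Q_of k p) *\<^sub>R (k 1 p *\<^sub>R \<P> 1 p + k 2 p *\<^sub>R \<P> 2 p + k 3 p *\<^sub>R \<P> 3 p)"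

definition normal2 ::
  "(3 \<Rightarrow> real \<times> real \<Rightarrow> real^4) \<Rightarrow> (3 \<Rightarrow> real \<times> real \<Rightarrow> real) \<Rightarrow> real \<times> real \<Rightarrow> real^4" where
  "normal2 \<P> k p =
     (1 / (Q_of k p * W_of k p)) *\<^sub>R
       ((k 2 p * S_of k p - k 3 p * R_of k p) *\<^sub>R \<P> 1 p
      + (k 3 p * P_of k p - k 1 p * S_of k p) *\<^sub>R \<P> 2 p
      + (k 1 p * R_of k p - k 2 p * P_of k p) *\<^sub>R \<P> 3 p)"

definition c11 :: "(real \<times> real \<Rightarrow> real^4) \<Rightarrow> (real \<times> real \<Rightarrow> real^4) \<Rightarrow> real \<times> real \<Rightarrow> real" where
  "c11 \<Psi> N p = pd_s (pd_s \<Psi>) p \<bullet> N p"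

text \<open>The subscript \<open>st\<close> is read as first \<open>s\<close>, then \<open>t\<close>.\<close>

definition c12 :: "(real \<times> real \<Rightarrow> real^4) \<Rightarrow> (real \<times> real \<Rightarrow> real^4) \<Rightarrow> real \<times> real \<Rightarrow> real" where
  "c12 \<Psi> N p = pd_t (pd_s \<Psi>) p \<bullet> N p"

definition c22 :: "(real \<times> real \<Rightarrow> real^4) \<Rightarrow> (real \<times> real \<Rightarrow> real^4) \<Rightarrow> real \<times> real \<Rightarrow> real" where
  "c22 \<Psi> N p = pd_t (pd_t \<Psi>) p \<bullet> N p"

definition Delta1 ::
  "(real \<times> real \<Rightarrow> real^4) \<Rightarrow> (real \<times> real \<Rightarrow> real^4) \<Rightarrow> (real \<times> real \<Rightarrow> real^4) \<Rightarrow> real \<times> real \<Rightarrow> real" where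
  "Delta1 \<Psi> N\<^sub>1 N\<^sub>2 p = c11 \<Psi> N\<^sub>1 p * c12 \<Psi> N\<^sub>2 p - c12 \<Psi> N\<^sub>1 p * c11 \<Psi> N\<^sub>2 p"

definition Delta2 ::
  "(real \<times> real \<Rightarrow> real^4) \<Rightarrow> (real \<times> real \<Rightarrow> real^4) \<Rightarrow> (real \<times> real \<Rightarrow> real^4) \<Rightarrow> real \<times> real \<Rightarrow> real" where
  "Delta2 \<Psi> N\<^sub>1 N\<^sub>2 p = c11 \<Psi> N\<^sub>1 p * c22 \<Psi> N\<^sub>2 p - c22 \<Psi> N\<^sub>1 p * c11 \<Psi> N\<^sub>2 p"

definition Delta3 ::
  "(real \<times> real \<Rightarrow> real^4) \<Rightarrow> (real \<times> real \<Rightarrow> real^4) \<Rightarrow> (real \<times> real \<Rightarrow> real^4) \<Rightarrow> real \<times> real \<Rightarrow> real" where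
  "Delta3 \<Psi> N\<^sub>1 N\<^sub>2 p = c12 \<Psi> N\<^sub>1 p * c22 \<Psi> N\<^sub>2 p - c22 \<Psi> N\<^sub>1 p * c12 \<Psi> N\<^sub>2 p"

text \<open>The denominator \<open>W_of k\<close> stands for the area density \<open>sqrt (g11 * g22 - g12\<^sup>2)\<close>; the two
  agree on a solution of the Betchov-Da Rios equation.\<close>

definition l11 ::
  "(real \<times> real \<Rightarrow> real^4) \<Rightarrow> (3 \<Rightarrow> real \<times> real \<Rightarrow> real^4) \<Rightarrow> (3 \<Rightarrow> real \<times> real \<Rightarrow> real) \<Rightarrow>
   real \<times> real \<Rightarrow> real" where
  "l11 \<Psi> \<P> k p = 2 * Delta1 \<Psi> (normal1 \<P> k) (normal2 \<P> k) p / W_of k p"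

definition l12 ::
  "(real \<times> real \<Rightarrow> real^4) \<Rightarrow> (3 \<Rightarrow> real \<times> real \<Rightarrow> real^4) \<Rightarrow> (3 \<Rightarrow> real \<times> real \<Rightarrow> real) \<Rightarrow>
   real \<times> real \<Rightarrow> real" where
  "l12 \<Psi> \<P> k p = Delta2 \<Psi> (normal1 \<P> k) (normal2 \<P> k) p / W_of k p"

definition l22 ::
  "(real \<times> real \<Rightarrow> real^4) \<Rightarrow> (3 \<Rightarrow> real \<times> real \<Rightarrow> real^4) \<Rightarrow> (3 \<Rightarrow> real \<times> real \<Rightarrow> real) \<Rightarrow>
   real \<times> real \<Rightarrow> real" where
  "l22 \<Psi> \<P> k p = 2 * Delta3 \<Psi> (normal1 \<P> k) (normal2 \<P> k) p / W_of k p"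

definition gamma_matrix ::
  "(real \<times> real \<Rightarrow> real^4) \<Rightarrow> (3 \<Rightarrow> real \<times> real \<Rightarrow> real^4) \<Rightarrow> (3 \<Rightarrow> real \<times> real \<Rightarrow> real) \<Rightarrow>
   real \<times> real \<Rightarrow> real^2^2" where
  "gamma_matrix \<Psi> \<P> k p =
     (let D = g11 \<Psi> p * g22 \<Psi> p - (g12 \<Psi> p)\<^sup>2 in
      vector
       [vector [(g12 \<Psi> p * l12 \<Psi> \<P> k p - g22 \<Psi> p * l11 \<Psi> \<P> k p) / D,
                (g12 \<Psi> p * l11 \<Psi> \<P> k p - g11 \<Psi> p * l12 \<Psi> \<P> k p) / D],
        vector [(g12 \<Psi> p * l22 \<Psi> \<P> k p - g22 \<Psi> p * l12 \<Psi> \<P> k p) / D,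
                (g12 \<Psi> p * l12 \<Psi> \<P> k p - g11 \<Psi> p * l22 \<Psi> \<P> k p) / D]])"

definition invariant_k ::
  "(real \<times> real \<Rightarrow> real^4) \<Rightarrow> (3 \<Rightarrow> real \<times> real \<Rightarrow> real^4) \<Rightarrow> (3 \<Rightarrow> real \<times> real \<Rightarrow> real) \<Rightarrow>
   real \<times> real \<Rightarrow> real" where
  "invariant_k \<Psi> \<P> k p = det (gamma_matrix \<Psi> \<P> k p)"

definition invariant_h ::
  "(real \<times> real \<Rightarrow> real^4) \<Rightarrow> (3 \<Rightarrow> real \<times> real \<Rightarrow> real^4) \<Rightarrow> (3 \<Rightarrow> real \<times> real \<Rightarrow> real) \<Rightarrow>
   real \<times> real \<Rightarrow> real" where
  "invariant_h \<Psi> \<P> k p = - (1/2) * trace (gamma_matrix \<Psi> \<P> k p)"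

end

theory Submission
  imports Defs
begin

text \<open>
  In the frame, \<open>\<Psi>\<^sub>s\<^sub>s = K\<close> with \<open>K = (k\<^sub>1, k\<^sub>2, k\<^sub>3)\<close> in the coordinates \<open>\<P>\<^sub>i\<close>, and the tangential part of
  \<open>\<Psi>\<^sub>s\<^sub>s\<^sub>s\<close> drops out of the ternary product, so the equation reads \<open>\<Psi>\<^sub>t = V\<close> with
  \<open>V = (P, R, S) = K\<^sub>s \<times> K\<close>. Hence \<open>g\<^sub>1\<^sub>1 = 1\<close>, \<open>g\<^sub>1\<^sub>2 = 0\<close>, \<open>g\<^sub>2\<^sub>2 = \<W>\<^sup>2\<close>, and \<open>\<Psi>\<^sub>s\<^sub>t = \<Psi>\<^sub>t\<^sub>s\<close> has coordinates
  \<open>V\<^sub>s\<close>. Differentiating \<open>\<langle>K, V\<rangle> = 0\<close> in \<open>s\<close> and \<open>t\<close> shows that \<open>(c\<^sub>1\<^sub>1, c\<^sub>1\<^sub>2, c\<^sub>2\<^sub>2)\<close> equals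
  \<open>(Q, 0, \<A> / Q)\<close> for \<open>N\<^sub>1\<close> and \<open>(0, Q \<C> / \<W>, \<B> / (Q \<W>))\<close> for \<open>N\<^sub>2 = K \<times> V / (Q \<W>)\<close>; the invariants
  follow by substitution.
\<close>

section \<open>Partial derivatives\<close>

lemma has_vector_derivative_pd_s:
  assumes "f differentiable (at (s, t))"
  shows "((\<lambda>x. f (x, t)) has_vector_derivative pd_s f (s, t)) (at s)"
proof -
  have "(\<lambda>x. (x, t)) differentiable (at s)"
    by (intro differentiable_Pair differentiable_ident differentiable_const)
  then have "(\<lambda>x. f (x, t)) differentiable (at s)"
    using differentiable_chain_at[of "\<lambda>x. (x, t)" s f] assms by (simp add: o_def)
  then show ?thesis
    by (simp add: pd_s_def vector_derivative_works)
qed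

text \<open>Swapping the coordinates exchanges the two partial derivatives, so several facts about
  \<open>pd_t\<close> are obtained from their counterparts for \<open>pd_s\<close>.\<close>

lemma pd_t_swap: "pd_t f (s, t) = pd_s (f \<circ> prod.swap) (t, s)"
  by (simp add: pd_s_def pd_t_def)

lemma differentiable_swap:
  assumes "f differentiable (at (s, t))"
  shows "(f \<circ> prod.swap) differentiable (at (t, s))"
proof (rule differentiable_chain_at)
  show "prod.swap differentiable (at (t, s))"
    unfolding prod.swap_def[abs_def]
    by (intro differentiable_Pair bounded_linear_imp_differentiable bounded_linear_fst bounded_linear_snd)
qed (use assms in simp)

lemma has_vector_derivative_pd_t:
  assumes "f differentiable (at (s, t))"
  shows "((\<lambda>y. f (s, y)) has_vector_derivative pd_t f (s, t)) (at t)"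
  using has_vector_derivative_pd_s[OF differentiable_swap[OF assms]] by (simp add: pd_t_swap)

lemma pd_s_eqI: "((\<lambda>x. f (x, t)) has_vector_derivative d) (at s) \<Longrightarrow> pd_s f (s, t) = d"
  by (simp add: pd_s_def vector_derivative_at)

lemma pd_t_eqI: "((\<lambda>y. f (s, y)) has_vector_derivative d) (at t) \<Longrightarrow> pd_t f (s, t) = d"
  by (simp add: pd_t_def vector_derivative_at)

text \<open>\<open>smooth_on\<close> speaks of Frechet derivatives along fixed vectors; this is the
  link from them to the partial derivative along the first axis.\<close>

lemma has_derivative_pd_s:
  assumes "(f has_derivative D) (at p)"
  shows "pd_s f p = D (1, 0)"
proof (cases p)
  case (Pair s t)
  have "((\<lambda>x. (x, t)) has_derivative (\<lambda>h. (h, 0))) (at s)"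
    by (auto intro!: derivative_eq_intros)
  from has_derivative_compose[OF this, of f D] assms Pair
  have "((\<lambda>x. f (x, t)) has_derivative (\<lambda>h. D (h, 0))) (at s)" by simp
  moreover have "(\<lambda>h. D (h, 0)) = (\<lambda>h. h *\<^sub>R D (1, 0))"
  proof
    show "D (h, 0) = h *\<^sub>R D (1, 0)" for h :: real
      using linear_cmul[OF has_derivative_linear[OF assms], of h "(1, 0)"] by simp
  qed
  ultimately show ?thesis
    unfolding Pair by (intro pd_s_eqI) (simp only: has_vector_derivative_def)
qed

lemma has_derivative_pd_t:
  assumes "(f has_derivative D) (at p)"
  shows "pd_t f p = D (0, 1)"
proof (cases p)
  case (Pair s t)
  have "((\<lambda>y. (s, y)) has_derivative (\<lambda>h. (0, h))) (at t)"
    by (auto intro!: derivative_eq_intros)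
  from has_derivative_compose[OF this, of f D] assms Pair
  have "((\<lambda>y. f (s, y)) has_derivative (\<lambda>h. D (0, h))) (at t)" by simp
  moreover have "(\<lambda>h. D (0, h)) = (\<lambda>h. h *\<^sub>R D (0, 1))"
  proof
    show "D (0, h) = h *\<^sub>R D (0, 1)" for h :: real
      using linear_cmul[OF has_derivative_linear[OF assms], of h "(0, 1)"] by simp
  qed
  ultimately show ?thesis
    unfolding Pair by (intro pd_t_eqI) (simp only: has_vector_derivative_def)
qed

section \<open>Regularity of partial derivatives and differentiation of local identities\<close>

lemma smooth_on_differentiable:
  assumes "smooth_on U f" "p \<in> U"
  shows "f differentiable (at p)"
proof -
  have "times_differentiable_on (Suc 0) U f"
    using assms(1) unfolding smooth_on_def ..
  then show ?thesis using assms(2) by simp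
qed

lemma smooth_on_frechet_derivative:
  assumes "smooth_on U f"
  shows "smooth_on U (\<lambda>x. frechet_derivative f (at x) v)"
  unfolding smooth_on_def
proof
  fix n
  have "times_differentiable_on (Suc n) U f"
    using assms unfolding smooth_on_def ..
  then show "times_differentiable_on n U (\<lambda>x. frechet_derivative f (at x) v)" by simp
qed

lemma differentiable_cong_open:
  assumes "f differentiable (at p)" "open U" "p \<in> U" "\<And>q. q \<in> U \<Longrightarrow> f q = g q"
  shows "g differentiable (at p)"
proof -
  obtain D where "(f has_derivative D) (at p)"
    using assms(1) by (auto simp: differentiable_def)
  then have "(g has_derivative D) (at p)"
    by (rule has_derivative_transform_within_open) (use assms in auto)
  then show ?thesis by (auto simp: differentiable_def)
qed

text \<open>On U the partial derivatives agree with Frechet derivatives along the axes, which are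
  again smooth. Openness of U lets differentiability at p pass across an equality known only on
  U.\<close>

lemma smooth_on_pd_differentiable:
  assumes "smooth_on U f" "open U" "p \<in> U"
  shows "pd_s f differentiable (at p)" "pd_t f differentiable (at p)"
proof -
  have D: "(f has_derivative frechet_derivative f (at q)) (at q)" if "q \<in> U" for q
    using smooth_on_differentiable[OF assms(1) that] by (simp add: frechet_derivative_works)
  have F: "(\<lambda>x. frechet_derivative f (at x) v) differentiable (at p)" for v
    by (rule smooth_on_differentiable[OF smooth_on_frechet_derivative[OF assms(1)] assms(3)])
  show "pd_s f differentiable (at p)"
    by (rule differentiable_cong_open[OF F assms(2,3)]) (simp add: has_derivative_pd_s[OF D])
  show "pd_t f differentiable (at p)"
    by (rule differentiable_cong_open[OF F assms(2,3)]) (simp add: has_derivative_pd_t[OF D])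
qed

text \<open>The frame relations hold on U only. Since U contains a short s-segment around p, such
  relations may still be differentiated at p.\<close>

lemma pd_s_cong_open:
  assumes "open U" "p \<in> U" "\<And>q. q \<in> U \<Longrightarrow> f q = g q"
  shows "pd_s f p = pd_s g p"
proof (cases p)
  case (Pair s t)
  have "open ((\<lambda>x. (x, t)) -` U)"
    by (intro open_vimage assms continuous_intros)
  moreover have "s \<in> (\<lambda>x. (x, t)) -` U" using assms Pair by simp
  ultimately have "eventually (\<lambda>x. x \<in> (\<lambda>x. (x, t)) -` U) (nhds s)"
    using eventually_nhds by blast
  then have "eventually (\<lambda>x. x \<in> UNIV \<longrightarrow> f (x, t) = g (x, t)) (nhds s)"
    by eventually_elim (use assms(3) in auto)
  then have "vector_derivative (\<lambda>x. f (x, t)) (at s) = vector_derivative (\<lambda>x. g (x, t)) (at s)"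
    by (intro vector_derivative_cong_eq refl UNIV_I)
  then show ?thesis
    by (simp add: Pair pd_s_def)
qed

lemma pd_t_cong_open:
  assumes "open U" "p \<in> U" "\<And>q. q \<in> U \<Longrightarrow> f q = g q"
  shows "pd_t f p = pd_t g p"
proof (cases p)
  case (Pair s t)
  have "open (prod.swap -` U)"
    by (intro open_vimage assms continuous_on_swap)
  then show ?thesis
    unfolding Pair pd_t_swap by (rule pd_s_cong_open) (use assms Pair in auto)
qed

section \<open>Product rules and equality of mixed partial derivatives\<close>

lemma pd_s_inner:
  assumes "f differentiable (at p)" "g differentiable (at p)"
  shows "pd_s (\<lambda>q. f q \<bullet> g q) p = f p \<bullet> pd_s g p + pd_s f p \<bullet> g p"
proof (cases p)
  case (Pair s t)
  show ?thesis
    using has_vector_derivative_pd_s[of f s t] has_vector_derivative_pd_s[of g s t] assms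
    unfolding Pair
    by (intro pd_s_eqI bounded_bilinear.has_vector_derivative[OF bounded_bilinear_inner])
qed

lemma pd_t_inner:
  assumes "f differentiable (at p)" "g differentiable (at p)"
  shows "pd_t (\<lambda>q. f q \<bullet> g q) p = f p \<bullet> pd_t g p + pd_t f p \<bullet> g p"
proof (cases p)
  case (Pair s t)
  show ?thesis
    using has_vector_derivative_pd_t[of f s t] has_vector_derivative_pd_t[of g s t] assms
    unfolding Pair
    by (intro pd_t_eqI bounded_bilinear.has_vector_derivative[OF bounded_bilinear_inner])
qed

text \<open>Young's form of the symmetry of second derivatives: this second difference quotient is symmetric
  under exchanging the variables, so its limit is both mixed derivatives.\<close>

lemma second_difference_tendsto:
  fixes f :: "real \<times> real \<Rightarrow> real"
  assumes "open U" "(s, t) \<in> U" and f: "\<And>q. q \<in> U \<Longrightarrow> f differentiable (at q)"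
    and "pd_s f differentiable (at (s, t))"
  shows "((\<lambda>h. (f (s + h, t + h) - f (s + h, t) - f (s, t + h) + f (s, t)) / h\<^sup>2)
           \<longlongrightarrow> pd_t (pd_s f) (s, t)) (at_right 0)"
proof (rule tendstoI)
  fix e :: real assume "e > 0"
  define \<phi> where "\<phi> = pd_s f"
  obtain D where D: "(\<phi> has_derivative D) (at (s, t))"
    using assms(4) unfolding \<phi>_def differentiable_def by blast
  have lin: "linear D" using D has_derivative_linear by blast
  obtain d where d: "d > 0" and
    dD: "\<And>q. norm (q - (s, t)) < d \<Longrightarrow>
           norm (\<phi> q - \<phi> (s, t) - D (q - (s, t))) \<le> e / 4 * norm (q - (s, t))"
    using D[unfolded has_derivative_at_alt, THEN conjunct2, rule_format, of "e / 4"] \<open>e > 0\<close>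
    by auto
  obtain r where r: "r > 0" "ball (s, t) r \<subseteq> U"
    using assms(1,2) openE by blast
  \<comment> \<open>Halving leaves room for the corner (s + h, t + h), which is up to 2 * h away
    from (s, t).\<close>
  define m where "m = min d r / 2"
  have m: "m > 0" using d r by (simp add: m_def)
  have *: "dist ((f (s + h, t + h) - f (s + h, t) - f (s, t + h) + f (s, t)) / h\<^sup>2) (D (0, 1)) < e"
    if h: "0 < h" "h < m" for h
  proof -
    have nrm: "norm ((x, y) - (s, t)) \<le> \<bar>x - s\<bar> + \<bar>y - t\<bar>" for x y :: real
      using norm_Pair_le[of "x - s" "y - t"] by simp
    have inU: "(x, y) \<in> U" if "\<bar>x - s\<bar> \<le> h" "\<bar>y - t\<bar> \<le> h" for x y
    proof -
      have "norm ((x, y) - (s, t)) < r"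
        using nrm[of x y] that h unfolding m_def by linarith
      then have "dist (s, t) (x, y) < r"
        by (metis dist_commute dist_norm)
      then show ?thesis using r by auto
    qed
    \<comment> \<open>The second difference is the increment over [s, s + h] of \<open>g\<close>, so
      the mean value theorem in s turns it into a difference of two values of \<open>\<phi>\<close>
      on one segment in the t-direction.\<close>
    define g where "g x = f (x, t + h) - f (x, t)" for x
    have "\<exists>z>s. z < s + h \<and> g (s + h) - g s = (s + h - s) * (\<phi> (z, t + h) - \<phi> (z, t))"
    proof (rule MVT2)
      show "s < s + h" using h by simp
      fix x assume "s \<le> x" "x \<le> s + h"
      then have "f differentiable (at (x, t + h))" "f differentiable (at (x, t))"
        using f inU h by auto
      then show "(g has_real_derivative \<phi> (x, t + h) - \<phi> (x, t)) (at x)"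
        unfolding g_def[abs_def] \<phi>_def has_real_derivative_iff_has_vector_derivative
        by (intro has_vector_derivative_diff has_vector_derivative_pd_s)
    qed
    then obtain z where z: "s < z" "z < s + h" and
      gz: "g (s + h) - g s = h * (\<phi> (z, t + h) - \<phi> (z, t))" by auto
    have n1: "norm ((z, t + h) - (s, t)) \<le> 2 * h" and n2: "norm ((z, t) - (s, t)) \<le> h"
      using nrm[of z "t + h"] nrm[of z t] z h by auto
    have b1: "norm (\<phi> (z, t + h) - \<phi> (s, t) - D ((z, t + h) - (s, t))) \<le> e / 4 * (2 * h)"
      by (rule order_trans[OF dD mult_left_mono]) (use n1 h \<open>e > 0\<close> in \<open>simp_all add: m_def\<close>)
    have b2: "norm (\<phi> (z, t) - \<phi> (s, t) - D ((z, t) - (s, t))) \<le> e / 4 * h"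
      by (rule order_trans[OF dD mult_left_mono]) (use n2 h \<open>e > 0\<close> in \<open>simp_all add: m_def\<close>)
    have "D ((z, t + h) - (s, t)) - D ((z, t) - (s, t)) = D (0, h)"
      using linear_diff[OF lin, of "(z, t + h) - (s, t)" "(z, t) - (s, t)"] by simp
    moreover have "D (0, h) = h * D (0, 1)"
      using linear_cmul[OF lin, of h "(0, 1)"] by simp
    \<comment> \<open>The two errors, e / 4 * (2 * h) and e / 4 * h, add up to 3 / 4 * e * h;
      division by h leaves a bound strictly below e.\<close>
    ultimately have b: "\<bar>\<phi> (z, t + h) - \<phi> (z, t) - h * D (0, 1)\<bar> \<le> 3 / 4 * e * h"
      using b1 b2 unfolding real_norm_def by linarith
    have fz: "f (s + h, t + h) - f (s + h, t) - f (s, t + h) + f (s, t) = h * (\<phi> (z, t + h) - \<phi> (z, t))"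
      using gz by (simp add: g_def)
    have "(f (s + h, t + h) - f (s + h, t) - f (s, t + h) + f (s, t)) / h\<^sup>2 - D (0, 1)
        = (\<phi> (z, t + h) - \<phi> (z, t) - h * D (0, 1)) / h"
      unfolding fz using h by (simp add: field_simps power2_eq_square)
    also have "\<bar>\<dots>\<bar> \<le> 3 / 4 * e"
      using b h by (simp add: abs_divide divide_le_eq)
    finally show ?thesis using \<open>e > 0\<close> by (simp add: dist_real_def)
  qed
  have "\<forall>\<^sub>F h in at_right 0. dist ((f (s + h, t + h) - f (s + h, t) - f (s, t + h) + f (s, t)) / h\<^sup>2) (D (0, 1)) < e"
    unfolding eventually_at_right_field using * m by blast
  then show "\<forall>\<^sub>F h in at_right 0.
      dist ((f (s + h, t + h) - f (s + h, t) - f (s, t + h) + f (s, t)) / h\<^sup>2) (pd_t (pd_s f) (s, t)) < e"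
    using has_derivative_pd_t[OF D] by (simp add: \<phi>_def)
qed

lemma pd_s_pd_t_commute_real:
  fixes f :: "real \<times> real \<Rightarrow> real"
  assumes "open U" "p \<in> U" and f: "\<And>q. q \<in> U \<Longrightarrow> f differentiable (at q)"
    and s: "pd_s f differentiable (at p)" and t: "pd_t f differentiable (at p)"
  shows "pd_t (pd_s f) p = pd_s (pd_t f) p"
proof (cases p)
  case (Pair x y)
  \<comment> \<open>For the swapped function the same second difference tends to the other mixed
    derivative.\<close>
  define g where "g = f \<circ> prod.swap"
  have pg: "pd_s g = pd_t f \<circ> prod.swap"
    by (auto simp: fun_eq_iff g_def pd_t_swap)
  have eq: "g (y + h, x + h) - g (y + h, x) - g (y, x + h) + g (y, x)
      = f (x + h, y + h) - f (x + h, y) - f (x, y + h) + f (x, y)" for h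
    by (simp add: g_def)
  have "((\<lambda>h. (g (y + h, x + h) - g (y + h, x) - g (y, x + h) + g (y, x)) / h\<^sup>2)
           \<longlongrightarrow> pd_t (pd_s g) (y, x)) (at_right 0)"
  proof (rule second_difference_tendsto)
    show "open (prod.swap -` U)"
      by (intro open_vimage assms continuous_on_swap)
    show "g differentiable (at q)" if "q \<in> prod.swap -` U" for q
      using that f differentiable_swap[of f "snd q" "fst q"] by (simp add: g_def prod.swap_def)
    show "pd_s g differentiable (at (y, x))"
      using differentiable_swap t Pair pg by metis
  qed (use assms Pair in auto)
  moreover have "pd_t (pd_s g) (y, x) = pd_s (pd_t f) (x, y)"
    by (simp add: pg pd_t_swap o_assoc[symmetric])
  ultimately have "((\<lambda>h. (f (x + h, y + h) - f (x + h, y) - f (x, y + h) + f (x, y)) / h\<^sup>2)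
           \<longlongrightarrow> pd_s (pd_t f) (x, y)) (at_right 0)"
    by (simp only: eq)
  moreover have "((\<lambda>h. (f (x + h, y + h) - f (x + h, y) - f (x, y + h) + f (x, y)) / h\<^sup>2)
           \<longlongrightarrow> pd_t (pd_s f) (x, y)) (at_right 0)"
    by (rule second_difference_tendsto) (use assms Pair in auto)
  ultimately show ?thesis
    unfolding Pair by (intro tendsto_unique[OF trivial_limit_at_right_real])
qed

text \<open>Reduction to the scalar case: pairing with a fixed vector v commutes with both partial
  derivatives, and v is finally taken to be the difference of the two sides.\<close>

lemma pd_s_pd_t_commute:
  fixes f :: "real \<times> real \<Rightarrow> 'a::real_inner"
  assumes U: "open U" "p \<in> U" and f: "smooth_on U f"
  shows "pd_t (pd_s f) p = pd_s (pd_t f) p"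
proof -
  have fd: "f differentiable (at q)" "pd_s f differentiable (at q)" "pd_t f differentiable (at q)"
    if "q \<in> U" for q
    using smooth_on_differentiable smooth_on_pd_differentiable f U that by blast+
  have "pd_t (pd_s f) p \<bullet> v = pd_s (pd_t f) p \<bullet> v" for v
  proof -
    have z: "pd_s (\<lambda>q. v) q = 0" "pd_t (\<lambda>q. v) q = 0" for q :: "real \<times> real"
      by (auto simp: pd_s_def pd_t_def split: prod.split)
    note [simp] = differentiable_inner fd
    define g where "g q = f q \<bullet> v" for q
    have gs: "pd_s g q = pd_s f q \<bullet> v" and gt: "pd_t g q = pd_t f q \<bullet> v" if "q \<in> U" for q
      unfolding g_def[abs_def] by (simp_all add: pd_s_inner pd_t_inner that z)
    have "pd_t (pd_s g) p = pd_s (pd_t g) p"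
    proof (rule pd_s_pd_t_commute_real[OF U])
      show "g differentiable (at q)" if "q \<in> U" for q
        unfolding g_def[abs_def] by (simp add: that)
      show "pd_s g differentiable (at p)"
        by (rule differentiable_cong_open[OF _ U, where f = "\<lambda>q. pd_s f q \<bullet> v"]) (auto simp: gs U)
      show "pd_t g differentiable (at p)"
        by (rule differentiable_cong_open[OF _ U, where f = "\<lambda>q. pd_t f q \<bullet> v"]) (auto simp: gt U)
    qed
    also have "pd_t (pd_s g) p = pd_t (\<lambda>q. pd_s f q \<bullet> v) p"
      by (rule pd_t_cong_open[OF U gs])
    also have "\<dots> = pd_t (pd_s f) p \<bullet> v"
      by (simp add: pd_t_inner U z)
    also have "pd_s (pd_t g) p = pd_s (\<lambda>q. pd_t f q \<bullet> v) p"
      by (rule pd_s_cong_open[OF U gt])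
    also have "\<dots> = pd_s (pd_t f) p \<bullet> v"
      by (simp add: pd_s_inner U z)
    finally show ?thesis .
  qed
  then have "(pd_t (pd_s f) p - pd_s (pd_t f) p) \<bullet> (pd_t (pd_s f) p - pd_s (pd_t f) p) = 0"
    by (simp only: inner_diff_left cancel_comm_monoid_add_class.diff_cancel)
  then show ?thesis by simp
qed

section \<open>Orthonormal frames and the ternary product\<close>

lemma vector_4 [simp]:
  "(vector [x, y, z, w] :: 'a::zero^4) $ 1 = x"
  "(vector [x, y, z, w] :: 'a::zero^4) $ 2 = y"
  "(vector [x, y, z, w] :: 'a::zero^4) $ 3 = z"
  "(vector [x, y, z, w] :: 'a::zero^4) $ 4 = w"
  by (simp_all add: vector_def)

lemma det_4:
  fixes A :: "'a::comm_ring_1^4^4"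
  shows "det A =
    A$1$1 * (A$2$2 * (A$3$3 * A$4$4 - A$3$4 * A$4$3) - A$2$3 * (A$3$2 * A$4$4 - A$3$4 * A$4$2)
           + A$2$4 * (A$3$2 * A$4$3 - A$3$3 * A$4$2))
  - A$1$2 * (A$2$1 * (A$3$3 * A$4$4 - A$3$4 * A$4$3) - A$2$3 * (A$3$1 * A$4$4 - A$3$4 * A$4$1)
           + A$2$4 * (A$3$1 * A$4$3 - A$3$3 * A$4$1))
  + A$1$3 * (A$2$1 * (A$3$2 * A$4$4 - A$3$4 * A$4$2) - A$2$2 * (A$3$1 * A$4$4 - A$3$4 * A$4$1)
           + A$2$4 * (A$3$1 * A$4$2 - A$3$2 * A$4$1))
  - A$1$4 * (A$2$1 * (A$3$2 * A$4$3 - A$3$3 * A$4$2) - A$2$2 * (A$3$1 * A$4$3 - A$3$3 * A$4$1)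
           + A$2$3 * (A$3$1 * A$4$2 - A$3$2 * A$4$1))"
proof -
  have f1: "finite {2::4, 3, 4}" "1 \<notin> {2::4, 3, 4}"
    and f2: "finite {3::4, 4}" "2 \<notin> {3::4, 4}"
    and f3: "finite {4::4}" "3 \<notin> {4::4}"
    by auto
  show ?thesis
    unfolding det_def UNIV_4
    unfolding sum_over_permutations_insert[OF f1]
    unfolding sum_over_permutations_insert[OF f2]
    unfolding sum_over_permutations_insert[OF f3]
    unfolding permutes_sing
    by (simp add: sign_swap_id permutation_swap_id permutation_compose sign_compose sign_id
        swap_id_eq algebra_simps)
qed

text \<open>A determinant is linear in its first row, so pairing with w puts w in place of the
  formal row of basis vectors.\<close>

lemma inner_ternary_product: "w \<bullet> ternary_product x y z = det (vector [w, x, y, z] :: real^4^4)"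
  by (simp add: ternary_product_def inner_vec_def sum_4 det_4 axis_def algebra_simps)

text \<open>E preserves inner products, and the entries of \<open>E *v x\<close> are the coordinates
  of x with respect to the rows of E.\<close>

lemma inner_orthogonal_rows:
  fixes E :: "real^'n^'n"
  assumes "orthogonal_matrix E"
  shows "x \<bullet> y = (\<Sum>i\<in>UNIV. (x \<bullet> E $ i) * (y \<bullet> E $ i))"
proof -
  have "orthogonal_transformation ((*v) E)"
    using assms by (simp add: orthogonal_transformation_matrix matrix_of_matrix_vector_mul)
  then have "x \<bullet> y = (E *v x) \<bullet> (E *v y)"
    by (simp add: orthogonal_transformation_def)
  then show ?thesis
    by (simp add: matrix_vector_mult_def inner_vec_def mult.commute)
qed

text \<open>Positive orientation forces det E = 1, so multiplying on the right by the transpose of E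
  keeps the determinant and replaces every row by its coordinates in the frame.\<close>

lemma inner_ternary_product_rotation:
  assumes E: "orthogonal_matrix E" "det E > 0"
  shows "E $ l \<bullet> ternary_product x y z =
     det (vector [axis l 1, E *v x, E *v y, E *v z] :: real^4^4)"
proof -
  let ?A = "vector [E $ l, x, y, z] :: real^4^4"
  have "det E = 1"
    using det_orthogonal_matrix[OF E(1)] E(2) by auto
  moreover have "E *v E $ l = axis l 1"
    using E(1) by (auto simp: orthogonal_matrix_orthonormal_rows row_def norm_eq_1 orthogonal_def
        vec_eq_iff matrix_vector_mul_component axis_def)
  then have "?A ** transpose E = vector [axis l 1, E *v x, E *v y, E *v z]"
    by (simp add: vec_eq_iff forall_4 matrix_matrix_mult_def transpose_def
        matrix_vector_mult_def mult.commute)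
  ultimately show ?thesis
    using det_mul[of ?A "transpose E"] by (simp add: inner_ternary_product)
qed

section \<open>Soliton surfaces\<close>

locale betchov_da_rios_surface =
  fixes U :: "(real \<times> real) set"
    and \<Psi> \<T> :: "real \<times> real \<Rightarrow> real^4"
    and \<P> :: "3 \<Rightarrow> real \<times> real \<Rightarrow> real^4"
    and k :: "3 \<Rightarrow> real \<times> real \<Rightarrow> real"
  assumes U: "open U"
    and smooth: "smooth_on U \<Psi>"
    and ptf: "parallel_transport_frame U \<Psi> \<T> \<P> k"
    and bdr: "betchov_da_rios U \<Psi>"
    and nondeg: "p \<in> U \<Longrightarrow> \<not> (P_of k p = 0 \<and> R_of k p = 0 \<and> S_of k p = 0)"
begin

section \<open>The frame, and the curvature functions as coordinates in it\<close>

lemma frame: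
  assumes "p \<in> U"
  shows "\<T> p \<bullet> \<T> p = 1" "\<T> p \<bullet> \<P> i p = 0" "\<P> i p \<bullet> \<T> p = 0"
    "\<P> i p \<bullet> \<P> j p = (if i = j then 1 else 0)"
    "det (vector [\<T> p, \<P> 1 p, \<P> 2 p, \<P> 3 p] :: real^4^4) > 0"
    "pd_s \<Psi> p = \<T> p"
    "pd_s \<T> p = k 1 p *\<^sub>R \<P> 1 p + k 2 p *\<^sub>R \<P> 2 p + k 3 p *\<^sub>R \<P> 3 p"
    "pd_s (\<P> i) p = - (k i p *\<^sub>R \<T> p)"
proof -
  note f1 = ptf[unfolded parallel_transport_frame_def, THEN conjunct2, THEN conjunct2, THEN bspec, OF assms]
  note f2 = f1[THEN conjunct2] note f3 = f2[THEN conjunct2] note f4 = f3[THEN conjunct2]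
  note f5 = f4[THEN conjunct2] note f6 = f5[THEN conjunct2] note f7 = f6[THEN conjunct2]
  show "\<T> p \<bullet> \<T> p = 1" by (rule f1[THEN conjunct1])
  show "\<T> p \<bullet> \<P> i p = 0" by (rule f2[THEN conjunct1, rule_format])
  then show "\<P> i p \<bullet> \<T> p = 0" by (simp only: inner_commute)
  show "\<P> i p \<bullet> \<P> j p = (if i = j then 1 else 0)" by (rule f3[THEN conjunct1, rule_format])
  show "det (vector [\<T> p, \<P> 1 p, \<P> 2 p, \<P> 3 p] :: real^4^4) > 0" by (rule f4[THEN conjunct1])
  show "pd_s \<Psi> p = \<T> p" by (rule f5[THEN conjunct1, symmetric])
  show "pd_s \<T> p = k 1 p *\<^sub>R \<P> 1 p + k 2 p *\<^sub>R \<P> 2 p + k 3 p *\<^sub>R \<P> 3 p"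
    by (rule f6[THEN conjunct1])
  show "pd_s (\<P> i) p = - (k i p *\<^sub>R \<T> p)" by (rule f7[rule_format])
qed

lemma differentiable_frame:
  assumes "p \<in> U"
  shows "\<T> differentiable (at p)" "\<P> i differentiable (at p)"
    "pd_s \<T> differentiable (at p)" "pd_t \<Psi> differentiable (at p)"
proof -
  have "smooth_on U \<T>" "smooth_on U (\<P> i)"
    using ptf unfolding parallel_transport_frame_def by blast+
  then show "\<T> differentiable (at p)" "\<P> i differentiable (at p)"
    "pd_s \<T> differentiable (at p)" "pd_t \<Psi> differentiable (at p)"
    using smooth U assms by (blast intro: smooth_on_differentiable smooth_on_pd_differentiable)+
qed

lemma frame_matrix: "p \<in> U \<Longrightarrow> orthogonal_matrix (vector [\<T> p, \<P> 1 p, \<P> 2 p, \<P> 3 p] :: real^4^4)"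
  by (simp add: orthogonal_matrix_orthonormal_rows row_def norm_eq_1 orthogonal_def forall_4 frame)

lemma inner_expand:
  assumes "p \<in> U"
  shows "x \<bullet> y = (x \<bullet> \<T> p) * (y \<bullet> \<T> p) + (x \<bullet> \<P> 1 p) * (y \<bullet> \<P> 1 p)
    + (x \<bullet> \<P> 2 p) * (y \<bullet> \<P> 2 p) + (x \<bullet> \<P> 3 p) * (y \<bullet> \<P> 3 p)"
  by (subst inner_orthogonal_rows[OF frame_matrix[OF assms]]) (simp add: sum_4)

text \<open>The frame assumption asks smoothness of the vector fields only. Written as inner
  products of differentiable fields, the functions \<open>k i\<close> can be differentiated
  too.\<close>

lemma pd_s_frame_inner:
  assumes "p \<in> U"
  shows "pd_s \<T> p \<bullet> \<T> p = 0" "pd_s \<T> p \<bullet> \<P> i p = k i p"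
  using exhaust_3[of i] by (auto simp: inner_add_left frame assms)

text \<open>The s-derivative of \<open>\<P> i\<close> is a multiple of \<open>\<T>\<close>, to which
  \<open>pd_s \<T>\<close> is orthogonal, so the product rule leaves a single term.\<close>

lemma pd_ss_frame_inner:
  assumes "p \<in> U"
  shows "pd_s (pd_s \<T>) p \<bullet> \<P> i p = pd_s (k i) p"
proof -
  have "pd_s (k i) p = pd_s (\<lambda>q. pd_s \<T> q \<bullet> \<P> i q) p"
    by (rule pd_s_cong_open[OF U assms]) (simp add: pd_s_frame_inner)
  then show ?thesis
    by (simp add: pd_s_inner differentiable_frame assms frame(8) pd_s_frame_inner)
qed

lemma pd_t_curvature:
  assumes "p \<in> U"
  shows "pd_t (k i) p = pd_s \<T> p \<bullet> pd_t (\<P> i) p + pd_t (pd_s \<T>) p \<bullet> \<P> i p"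
proof -
  have "pd_t (k i) p = pd_t (\<lambda>q. pd_s \<T> q \<bullet> \<P> i q) p"
    by (rule pd_t_cong_open[OF U assms]) (simp add: pd_s_frame_inner)
  then show ?thesis
    by (simp add: pd_t_inner differentiable_frame assms)
qed

section \<open>The evolution equation in frame coordinates\<close>

lemma pd_ss_Psi:
  assumes "p \<in> U"
  shows "pd_s (pd_s \<Psi>) p = pd_s \<T> p" "pd_s (pd_s (pd_s \<Psi>)) p = pd_s (pd_s \<T>) p"
proof -
  have *: "pd_s (pd_s \<Psi>) q = pd_s \<T> q" if "q \<in> U" for q
    by (rule pd_s_cong_open[OF U that]) (rule frame)
  from assms show "pd_s (pd_s \<Psi>) p = pd_s \<T> p" by (rule *)
  show "pd_s (pd_s (pd_s \<Psi>)) p = pd_s (pd_s \<T>) p"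
    by (rule pd_s_cong_open[OF U assms *])
qed

lemma pd_t_Psi_inner:
  assumes "p \<in> U"
  shows "pd_t \<Psi> p \<bullet> \<T> p = 0" "pd_t \<Psi> p \<bullet> \<P> 1 p = P_of k p"
    "pd_t \<Psi> p \<bullet> \<P> 2 p = R_of k p" "pd_t \<Psi> p \<bullet> \<P> 3 p = S_of k p"
proof -
  let ?E = "vector [\<T> p, \<P> 1 p, \<P> 2 p, \<P> 3 p] :: real^4^4"
  have "pd_t \<Psi> p = ternary_product (\<T> p) (pd_s \<T> p) (pd_s (pd_s \<T>) p)"
    using bdr assms by (simp add: betchov_da_rios_def frame(6) pd_ss_Psi)
  \<comment> \<open>In frame coordinates \<open>\<T> p\<close> becomes the first basis vector. It
    repeats the first row for l = 1 and removes the first column for the other l, leaving the 2 x 2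
    minors of K and K_s.\<close>
  then have "pd_t \<Psi> p \<bullet> ?E $ l = det (vector [axis l 1, ?E *v \<T> p, ?E *v pd_s \<T> p,
      ?E *v pd_s (pd_s \<T>) p] :: real^4^4)" for l
    using inner_ternary_product_rotation[OF frame_matrix[OF assms] frame(5)[OF assms]]
    by (simp add: inner_commute)
  note * = this[of 1] this[of 2] this[of 3] this[of 4]
  show "pd_t \<Psi> p \<bullet> \<T> p = 0" "pd_t \<Psi> p \<bullet> \<P> 1 p = P_of k p"
    "pd_t \<Psi> p \<bullet> \<P> 2 p = R_of k p" "pd_t \<Psi> p \<bullet> \<P> 3 p = S_of k p"
    using * assms
    by (simp_all add: det_4 matrix_vector_mul_component axis_def frame(1-4)
        inner_commute[of _ "pd_s \<T> p"] inner_commute[of _ "pd_s (pd_s \<T>) p"]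
        pd_s_frame_inner pd_ss_frame_inner P_of_def R_of_def S_of_def)
qed

text \<open>A cross product K_s x K is orthogonal to K; as a polynomial identity this holds at every
  point.\<close>

lemma curvature_orthogonal: "k 1 p * P_of k p + k 2 p * R_of k p + k 3 p * S_of k p = 0"
  by (simp add: P_of_def R_of_def S_of_def algebra_simps)

text \<open>Here \<open>f\<close> stands for \<open>P_of k\<close>, \<open>R_of k\<close> or
  \<open>S_of k\<close>. The s-derivative of \<open>\<P> i\<close> is tangential while the velocity
  has no tangential part, so differentiating the frame contributes nothing; the mixed derivatives
  are then exchanged.\<close>

lemma pd_s_velocity:
  assumes "p \<in> U" "\<And>q. q \<in> U \<Longrightarrow> f q = pd_t \<Psi> q \<bullet> \<P> i q"
  shows "pd_s f p = pd_t (pd_s \<Psi>) p \<bullet> \<P> i p"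
proof -
  have "pd_s f p = pd_s (\<lambda>q. pd_t \<Psi> q \<bullet> \<P> i q) p"
    by (rule pd_s_cong_open[OF U assms])
  then show ?thesis
    using assms(1)
    by (simp add: pd_s_inner differentiable_frame frame(8) pd_t_Psi_inner
        pd_s_pd_t_commute[OF U _ smooth])
qed

lemma pd_t_velocity:
  assumes "p \<in> U" "\<And>q. q \<in> U \<Longrightarrow> f q = pd_t \<Psi> q \<bullet> \<P> i q"
  shows "pd_t f p = pd_t \<Psi> p \<bullet> pd_t (\<P> i) p + pd_t (pd_t \<Psi>) p \<bullet> \<P> i p"
proof -
  have "pd_t f p = pd_t (\<lambda>q. pd_t \<Psi> q \<bullet> \<P> i q) p"
    by (rule pd_t_cong_open[OF U assms])
  then show ?thesis
    using assms(1) by (simp add: pd_t_inner differentiable_frame)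
qed

section \<open>Rotation of the frame in t and the second derivatives of the surface\<close>

lemma pd_t_frame_antisym:
  assumes "p \<in> U"
  shows "pd_t (\<P> i) p \<bullet> \<P> j p = - (pd_t (\<P> j) p \<bullet> \<P> i p)"
proof -
  have "pd_t (\<lambda>q. \<P> i q \<bullet> \<P> j q) p = pd_t (\<lambda>q. if i = j then 1 else 0) p"
    by (rule pd_t_cong_open[OF U assms]) (simp add: frame)
  also have "\<dots> = 0"
    by (auto simp: pd_t_def split: prod.split)
  finally show ?thesis
    by (simp add: pd_t_inner differentiable_frame assms inner_commute)
qed

lemma pd_t_frame_inner:
  assumes "p \<in> U"
  shows "pd_t (\<P> i) p \<bullet> \<P> i p = 0"
    "pd_t (\<P> 1) p \<bullet> \<P> 2 p = coef_a23 \<P> p" "pd_t (\<P> 2) p \<bullet> \<P> 1 p = - coef_a23 \<P> p"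
    "pd_t (\<P> 1) p \<bullet> \<P> 3 p = coef_a24 \<P> p" "pd_t (\<P> 3) p \<bullet> \<P> 1 p = - coef_a24 \<P> p"
    "pd_t (\<P> 2) p \<bullet> \<P> 3 p = coef_a34 \<P> p" "pd_t (\<P> 3) p \<bullet> \<P> 2 p = - coef_a34 \<P> p"
  using pd_t_frame_antisym[OF assms, of i i] pd_t_frame_antisym[OF assms, of 2 1]
    pd_t_frame_antisym[OF assms, of 3 1] pd_t_frame_antisym[OF assms, of 3 2]
  by (simp_all add: coef_a23_def coef_a24_def coef_a34_def)

lemma pd_s_PRS:
  assumes "p \<in> U"
  shows "pd_t (pd_s \<Psi>) p \<bullet> \<P> 1 p = pd_s (P_of k) p"
    "pd_t (pd_s \<Psi>) p \<bullet> \<P> 2 p = pd_s (R_of k) p"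
    "pd_t (pd_s \<Psi>) p \<bullet> \<P> 3 p = pd_s (S_of k) p"
  by (rule pd_s_velocity[symmetric], rule assms, simp add: pd_t_Psi_inner)+

text \<open>In the t-direction the normal frame does rotate, which produces the correction terms.
  Any tangential part of the t-derivative of \<open>\<P> i\<close> is paired with the vanishing
  tangential velocity.\<close>

lemma pd_t_PRS:
  assumes "p \<in> U"
  shows "pd_t (pd_t \<Psi>) p \<bullet> \<P> 1 p
      = pd_t (P_of k) p - R_of k p * coef_a23 \<P> p - S_of k p * coef_a24 \<P> p"
    "pd_t (pd_t \<Psi>) p \<bullet> \<P> 2 p
      = pd_t (R_of k) p + P_of k p * coef_a23 \<P> p - S_of k p * coef_a34 \<P> p"
    "pd_t (pd_t \<Psi>) p \<bullet> \<P> 3 p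
      = pd_t (S_of k) p + P_of k p * coef_a24 \<P> p + R_of k p * coef_a34 \<P> p"
  using pd_t_velocity[OF assms, of "P_of k" 1] pd_t_velocity[OF assms, of "R_of k" 2]
    pd_t_velocity[OF assms, of "S_of k" 3]
    inner_expand[OF assms, of "pd_t \<Psi> p" "pd_t (\<P> 1) p"]
    inner_expand[OF assms, of "pd_t \<Psi> p" "pd_t (\<P> 2) p"]
    inner_expand[OF assms, of "pd_t \<Psi> p" "pd_t (\<P> 3) p"] assms
  by (simp_all add: pd_t_Psi_inner pd_t_frame_inner)

text \<open>Differentiating <K, V> = 0 in t moves the derivative from the velocity to the curvature
  vector. Hence \<open>A_of\<close> contains t-derivatives of the curvature functions and none of P,
  R, S.\<close>

lemma pd_s_T_inner_pd_tt: "p \<in> U \<Longrightarrow> pd_s \<T> p \<bullet> pd_t (pd_t \<Psi>) p = A_of \<P> k p"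
proof -
  assume p: "p \<in> U"
  have "pd_t (\<lambda>q. pd_s \<T> q \<bullet> pd_t \<Psi> q) p = pd_t (\<lambda>q. 0) p"
  proof (rule pd_t_cong_open[OF U p])
    fix q assume "q \<in> U"
    then show "pd_s \<T> q \<bullet> pd_t \<Psi> q = 0"
      using inner_expand[of q "pd_s \<T> q" "pd_t \<Psi> q"] curvature_orthogonal[of q]
      by (simp add: pd_s_frame_inner pd_t_Psi_inner)
  qed
  then have "pd_s \<T> p \<bullet> pd_t (pd_t \<Psi>) p = - (pd_t (pd_s \<T>) p \<bullet> pd_t \<Psi> p)"
    using p pd_t_inner[of "pd_s \<T>" p "pd_t \<Psi>"]
    by (simp add: differentiable_frame) (simp add: pd_t_def split: prod.splits)
  also have "\<dots> = A_of \<P> k p"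
  proof -
    \<comment> \<open>The derivative of a coordinate of K, corrected by the rotation of the
      frame.\<close>
    have *: "pd_t (pd_s \<T>) p \<bullet> \<P> i p = pd_t (k i) p - (k 1 p * (pd_t (\<P> i) p \<bullet> \<P> 1 p)
        + k 2 p * (pd_t (\<P> i) p \<bullet> \<P> 2 p) + k 3 p * (pd_t (\<P> i) p \<bullet> \<P> 3 p))" for i
      using pd_t_curvature[OF p, of i] inner_expand[OF p, of "pd_s \<T> p" "pd_t (\<P> i) p"] p
      by (simp add: pd_s_frame_inner)
    show ?thesis
      using p inner_expand[OF p, of "pd_t (pd_s \<T>) p" "pd_t \<Psi> p"]
      by (simp add: * pd_t_Psi_inner pd_t_frame_inner A_of_def algebra_simps)
  qed
  finally show ?thesis .
qed

text \<open>Differentiating <K, V> = 0 in s leaves minus the pairing of the s-derivative of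
  \<open>pd_s \<T>\<close> with the velocity. The velocity being normal, that pairing is the triple
  product of K_s with K_s x K, which is zero.\<close>

lemma pd_s_T_inner_pd_st: "p \<in> U \<Longrightarrow> pd_s \<T> p \<bullet> pd_t (pd_s \<Psi>) p = 0"
proof -
  assume p: "p \<in> U"
  have "pd_s (\<lambda>q. pd_s \<T> q \<bullet> pd_t \<Psi> q) p = pd_s (\<lambda>q. 0) p"
  proof (rule pd_s_cong_open[OF U p])
    fix q assume "q \<in> U"
    then show "pd_s \<T> q \<bullet> pd_t \<Psi> q = 0"
      using inner_expand[of q "pd_s \<T> q" "pd_t \<Psi> q"] curvature_orthogonal[of q]
      by (simp add: pd_s_frame_inner pd_t_Psi_inner)
  qed
  then have "pd_s \<T> p \<bullet> pd_t (pd_s \<Psi>) p = - (pd_s (pd_s \<T>) p \<bullet> pd_t \<Psi> p)"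
    using p pd_s_inner[of "pd_s \<T>" p "pd_t \<Psi>"]
    by (simp add: differentiable_frame pd_s_pd_t_commute[OF U p smooth])
      (simp add: pd_s_def split: prod.splits)
  also have "\<dots> = 0"
    using p inner_expand[OF p, of "pd_s (pd_s \<T>) p" "pd_t \<Psi> p"]
    by (simp add: pd_t_Psi_inner pd_ss_frame_inner P_of_def R_of_def S_of_def algebra_simps)
  finally show ?thesis .
qed

section \<open>The fundamental forms\<close>

lemma Q_square: "(Q_of k p)\<^sup>2 = (k 1 p)\<^sup>2 + (k 2 p)\<^sup>2 + (k 3 p)\<^sup>2"
  by (simp add: Q_of_def)

lemma W_square: "(W_of k p)\<^sup>2 = (P_of k p)\<^sup>2 + (R_of k p)\<^sup>2 + (S_of k p)\<^sup>2"
  by (simp add: W_of_def)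

lemma W_pos: "p \<in> U \<Longrightarrow> W_of k p > 0"
  using nondeg[of p] unfolding W_of_def
  by (auto simp: sum_power2_gt_zero_iff add_pos_nonneg add_nonneg_pos)

text \<open>If K vanished at p, so would P, R and S, against \<open>nondeg\<close>.\<close>

lemma Q_pos: "p \<in> U \<Longrightarrow> Q_of k p > 0"
proof -
  assume "p \<in> U"
  then have "\<not> (k 1 p = 0 \<and> k 2 p = 0 \<and> k 3 p = 0)"
    using nondeg[of p] by (auto simp: P_of_def R_of_def S_of_def)
  then show ?thesis unfolding Q_of_def
    by (auto simp: sum_power2_gt_zero_iff add_pos_nonneg add_nonneg_pos)
qed

lemma first_fundamental_form:
  assumes "p \<in> U"
  shows "g11 \<Psi> p = 1" "g12 \<Psi> p = 0" "g22 \<Psi> p = (W_of k p)\<^sup>2"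
  using assms inner_expand[OF assms, of "pd_t \<Psi> p" "pd_t \<Psi> p"]
  by (simp_all add: g11_def g12_def g22_def frame pd_t_Psi_inner inner_commute[of "\<T> p" "pd_t \<Psi> p"]
      W_square[unfolded power2_eq_square] power2_eq_square)

text \<open>Reduces the coefficients for N_1 to the inner products with \<open>pd_s \<T>\<close>
  computed above.\<close>

lemma normal1_eq: "p \<in> U \<Longrightarrow> normal1 \<P> k p = (1 / Q_of k p) *\<^sub>R pd_s \<T> p"
  by (simp add: normal1_def frame(7))

lemma c_normal1:
  assumes "p \<in> U"
  shows "c11 \<Psi> (normal1 \<P> k) p = Q_of k p" "c12 \<Psi> (normal1 \<P> k) p = 0"
    "c22 \<Psi> (normal1 \<P> k) p = A_of \<P> k p / Q_of k p"
proof -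
  have "pd_s \<T> p \<bullet> pd_s \<T> p = (Q_of k p)\<^sup>2"
    using inner_expand[OF assms, of "pd_s \<T> p" "pd_s \<T> p"] assms
    by (simp add: pd_s_frame_inner Q_square[unfolded power2_eq_square] power2_eq_square)
  then show "c11 \<Psi> (normal1 \<P> k) p = Q_of k p"
    using Q_pos[OF assms] by (simp add: c11_def normal1_eq assms pd_ss_Psi power2_eq_square)
  show "c12 \<Psi> (normal1 \<P> k) p = 0"
    using pd_s_T_inner_pd_st[OF assms] by (simp add: c12_def normal1_eq assms inner_commute)
  show "c22 \<Psi> (normal1 \<P> k) p = A_of \<P> k p / Q_of k p"
    using pd_s_T_inner_pd_tt[OF assms] by (simp add: c22_def normal1_eq assms inner_commute)
qed

lemma inner_normal2:
  "x \<bullet> normal2 \<P> k p =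
     ((k 2 p * S_of k p - k 3 p * R_of k p) * (x \<bullet> \<P> 1 p)
    + (k 3 p * P_of k p - k 1 p * S_of k p) * (x \<bullet> \<P> 2 p)
    + (k 1 p * R_of k p - k 2 p * P_of k p) * (x \<bullet> \<P> 3 p)) / (Q_of k p * W_of k p)"
  by (simp add: normal2_def inner_add_right)

lemma c_normal2:
  assumes "p \<in> U"
  shows "c11 \<Psi> (normal2 \<P> k) p = 0" "c12 \<Psi> (normal2 \<P> k) p = Q_of k p * C_of k p / W_of k p"
    "c22 \<Psi> (normal2 \<P> k) p = B_of \<P> k p / (Q_of k p * W_of k p)"
proof -
  show "c11 \<Psi> (normal2 \<P> k) p = 0"
    by (simp add: c11_def inner_normal2 assms pd_ss_Psi pd_s_frame_inner algebra_simps)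
  have "k 1 p * pd_s (P_of k) p + k 2 p * pd_s (R_of k) p + k 3 p * pd_s (S_of k) p = 0"
    using pd_s_T_inner_pd_st[OF assms] inner_expand[OF assms, of "pd_s \<T> p" "pd_t (pd_s \<Psi>) p"]
    by (simp add: assms pd_s_frame_inner pd_s_PRS)
  \<comment> \<open>By the vector triple product, K x V = K x (K_s x K) = Q^2 K_s - <K, K_s> K.
    Pairing with V_s removes the last term because <K, V_s> = 0, and <K_s, V_s> is
    \<open>C_of k p\<close>.\<close>
  then have "(k 2 p * S_of k p - k 3 p * R_of k p) * pd_s (P_of k) p
    + (k 3 p * P_of k p - k 1 p * S_of k p) * pd_s (R_of k) p
    + (k 1 p * R_of k p - k 2 p * P_of k p) * pd_s (S_of k) p = (Q_of k p)\<^sup>2 * C_of k p"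
    unfolding Q_square P_of_def[of k p] R_of_def[of k p] S_of_def[of k p] C_of_def by algebra
  then show "c12 \<Psi> (normal2 \<P> k) p = Q_of k p * C_of k p / W_of k p"
    using Q_pos[OF assms] by (simp add: c12_def inner_normal2 assms pd_s_PRS power2_eq_square)
  show "c22 \<Psi> (normal2 \<P> k) p = B_of \<P> k p / (Q_of k p * W_of k p)"
    \<comment> \<open>The rotation terms of \<open>pd_t_PRS\<close> form the cross product of w =
      (a34, -a24, a23) with V. By Lagrange's identity and <K, V> = 0, its pairing with K x V is W^2
      <K, w>, the first term of \<open>B_of\<close>.\<close>
    unfolding c22_def inner_normal2 pd_t_PRS[OF assms] B_of_def W_square
    using curvature_orthogonal[of p] by (intro arg_cong2[where f = "(/)"] refl) algebra
qed

lemma invariants: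
  assumes "p \<in> U"
  shows "invariant_k \<Psi> \<P> k p =
      - (((B_of \<P> k p)\<^sup>2 + 4 * (Q_of k p)\<^sup>2 * A_of \<P> k p * (C_of k p)\<^sup>2) / (W_of k p) ^ 6)"
    "invariant_h \<Psi> \<P> k p =
      ((Q_of k p)\<^sup>2 * (W_of k p)\<^sup>2 - A_of \<P> k p) * C_of k p / (W_of k p) ^ 4"
proof -
  note QW = Q_pos[OF assms] W_pos[OF assms]
  \<comment> \<open>The coefficient c_12 for N_1 and the coefficient c_11 for N_2 vanish, so each
    Delta keeps one product.\<close>
  have l: "l11 \<Psi> \<P> k p = 2 * (Q_of k p)\<^sup>2 * C_of k p / (W_of k p)\<^sup>2"
    "l12 \<Psi> \<P> k p = B_of \<P> k p / (W_of k p)\<^sup>2"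
    "l22 \<Psi> \<P> k p = - 2 * A_of \<P> k p * C_of k p / (W_of k p)\<^sup>2"
    using QW by (simp_all add: l11_def l12_def l22_def Delta1_def Delta2_def Delta3_def
        c_normal1 c_normal2 assms field_simps power2_eq_square)
  \<comment> \<open>With g_11 = 1, g_12 = 0 and g_22 = D = W^2, the factor g_22 cancels D in the
    first column.\<close>
  have g: "gamma_matrix \<Psi> \<P> k p = vector
      [vector [- l11 \<Psi> \<P> k p, - (l12 \<Psi> \<P> k p / (W_of k p)\<^sup>2)],
       vector [- l12 \<Psi> \<P> k p, - (l22 \<Psi> \<P> k p / (W_of k p)\<^sup>2)]]"
    using QW by (simp add: gamma_matrix_def first_fundamental_form assms Let_def)
  \<comment> \<open>All powers are expressed through W^2, which \<open>divide_simps\<close> can then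
    treat as one nonzero quantity.\<close>
  have pow: "(W_of k p) ^ 4 = (W_of k p)\<^sup>2 * (W_of k p)\<^sup>2"
    "(W_of k p) ^ 6 = (W_of k p)\<^sup>2 * (W_of k p)\<^sup>2 * (W_of k p)\<^sup>2"
    by (simp_all flip: power_add)
  have "(W_of k p)\<^sup>2 \<noteq> 0" using QW by simp
  then show "invariant_k \<Psi> \<P> k p =
      - (((B_of \<P> k p)\<^sup>2 + 4 * (Q_of k p)\<^sup>2 * A_of \<P> k p * (C_of k p)\<^sup>2) / (W_of k p) ^ 6)"
    unfolding invariant_k_def g det_2 l pow
    by (simp add: divide_simps)
      (simp add: power2_eq_square[of "B_of _ _ _"] power2_eq_square[of "C_of _ _"] algebra_simps)
  show "invariant_h \<Psi> \<P> k p =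
      ((Q_of k p)\<^sup>2 * (W_of k p)\<^sup>2 - A_of \<P> k p) * C_of k p / (W_of k p) ^ 4"
    using \<open>(W_of k p)\<^sup>2 \<noteq> 0\<close>
    unfolding invariant_h_def g trace_def sum_2 l pow
    by (simp add: divide_simps) (simp add: algebra_simps)
qed

end

theorem theorem2:
  fixes I J :: "real set"
    and \<Psi> \<T> :: "real \<times> real \<Rightarrow> real^4"
    and \<P> :: "3 \<Rightarrow> real \<times> real \<Rightarrow> real^4"
    and k :: "3 \<Rightarrow> real \<times> real \<Rightarrow> real"
  assumes "open I" and "is_interval I" and "I \<noteq> {}"
    and "open J" and "is_interval J" and "J \<noteq> {}"
    and "smooth_on (I \<times> J) \<Psi>"
    and "\<forall>p\<in>I \<times> J. norm (pd_s \<Psi> p) = 1"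
    and "parallel_transport_frame (I \<times> J) \<Psi> \<T> \<P> k"
    and "\<exists>i j. i \<noteq> j \<and> (\<exists>p\<in>I \<times> J. k i p \<noteq> 0) \<and> (\<exists>p\<in>I \<times> J. k j p \<noteq> 0)"
    and "\<forall>p\<in>I \<times> J. \<not> (P_of k p = 0 \<and> R_of k p = 0 \<and> S_of k p = 0)"
    and "betchov_da_rios (I \<times> J) \<Psi>"
  shows "\<forall>p\<in>I \<times> J.
    invariant_k \<Psi> \<P> k p =
      - (((B_of \<P> k p)\<^sup>2 + 4 * (Q_of k p)\<^sup>2 * A_of \<P> k p * (C_of k p)\<^sup>2) / (W_of k p) ^ 6) \<and>
    invariant_h \<Psi> \<P> k p =
      ((Q_of k p)\<^sup>2 * (W_of k p)\<^sup>2 - A_of \<P> k p) * C_of k p / (W_of k p) ^ 4"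
proof -
  interpret betchov_da_rios_surface "I \<times> J" \<Psi> \<T> \<P> k
    by unfold_locales (use assms in \<open>blast intro: open_Times\<close>)+
  show ?thesis
    using invariants by blast
qed

end
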